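(* Let $Y$ be a random variable whose moment generating function $E[e^{tY}]$ exists for $|t|<r$, for some $r>0$. Define $T^{Y}(n,k)$ by $\frac{1}{k!}\big(E[e^{\frac{Y}{2}t}]-E[e^{-\frac{Y}{2}t}]\big)^{k}=\sum_{n=k}^{\infty}T^{Y}(n,k)\frac{t^{n}}{n!}$ $(k\ge0)$, and $B_{n}^{(c,Y)}(x)=\sum_{k=0}^{n}T^{Y}(n,k)x^{k}$. Then for all $n\ge k\ge 0$, $$B_{n,k}\Big(B_{1}^{(c,Y)}(x),B_{2}^{(c,Y)}(x),\dots,B_{n-k+1}^{(c,Y)}(x)\Big)=\sum_{j=k}^{n}{j\brace k}T^{Y}(n,j)x^{j}.$$
   Context: ${j\brace k}$ denotes the (ordinary) Stirling numbers of the second kind, given by $x^n=\sum_{k=0}^n{n\brace k}x(x-1)\cdots(x-k+1)$. The partial Bell polynomials $B_{n,k}$ are defined by $\frac{1}{k!}\big(\sum_{m=1}^{\infty}x_{m}\frac{t^{m}}{m!}\big)^{k}=\sum_{n=k}^{\infty}B_{n,k}(x_{1},\dots,x_{n-k+1})\frac{t^{n}}{n!}$. *)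

theory Defs
  imports "HOL-Probability.Probability" "HOL-Combinatorics.Stirling"
begin

text \<open>
  The library defines \<^const>\<open>Stirling\<close> by its recurrence; it satisfies the
  defining identity in terms of falling factorials.
\<close>

lemma power_eq_sum_Stirling:
  fixes x :: "'a::comm_ring_1"
  shows "x ^ n = (\<Sum>k\<le>n. of_nat (Stirling n k) * (\<Prod>i<k. x - of_nat i))"
proof (induction n)
  case 0
  then show ?case by simp
next
  case (Suc n)
  define p where "p k = (\<Prod>i<k. x - of_nat i)" for k
  have p_Suc: "x * p k = p (Suc k) + of_nat k * p k" for k
    by (simp add: p_def algebra_simps)
  have "x ^ Suc n = (\<Sum>k\<le>n. of_nat (Stirling n k) * (x * p k))"
    using Suc.IH by (simp add: p_def sum_distrib_left mult_ac)
  also have "\<dots> = (\<Sum>k\<le>n. of_nat (Stirling n k) * p (Suc k))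
      + (\<Sum>k\<le>n. of_nat (k * Stirling n k) * p k)"
    by (simp add: p_Suc algebra_simps sum.distrib)
  also have "(\<Sum>k\<le>n. of_nat (k * Stirling n k) * p k)
      = (\<Sum>k\<le>Suc n. of_nat (k * Stirling n k) * p k)"
    by simp
  also have "\<dots> = (\<Sum>k\<le>n. of_nat (Suc k * Stirling n (Suc k)) * p (Suc k))"
    by (subst sum.atMost_Suc_shift) simp
  also have "(\<Sum>k\<le>n. of_nat (Stirling n k) * p (Suc k)) + \<dots>
      = (\<Sum>k\<le>n. of_nat (Stirling (Suc n) (Suc k)) * p (Suc k))"
    by (simp add: sum.distrib [symmetric] algebra_simps)
  also have "\<dots> = (\<Sum>k\<le>Suc n. of_nat (Stirling (Suc n) k) * p k)"
    by (subst sum.atMost_Suc_shift) simp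
  finally show ?case by (simp add: p_def)
qed

text \<open>
  The arguments of the partial Bell polynomial are given as a sequence \<open>x\<close>, of which
  only the entries \<open>x 1, \<dots>, x (n - k + 1)\<close> matter (see \<open>partial_Bell_cong\<close> below).
\<close>

definition partial_Bell :: "nat \<Rightarrow> nat \<Rightarrow> (nat \<Rightarrow> real) \<Rightarrow> real" where
  "partial_Bell n k x = fact n * fps_nth
     (fps_const (1 / fact k) * Abs_fps (\<lambda>m. if m = 0 then 0 else x m / fact m) ^ k) n"

lemma partial_Bell_cong:
  assumes "\<And>m. 1 \<le> m \<Longrightarrow> m \<le> n - k + 1 \<Longrightarrow> x m = y m"
  shows "partial_Bell n k x = partial_Bell n k y"
proof -
  define G where "G z = Abs_fps (\<lambda>m. z (Suc m) / fact (Suc m))" for z :: "nat \<Rightarrow> real"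
  have shift: "Abs_fps (\<lambda>m. if m = 0 then 0 else z m / fact m) = fps_X * G z"
    for z :: "nat \<Rightarrow> real"
  proof (rule fps_ext)
    fix i
    show "fps_nth (Abs_fps (\<lambda>m. if m = 0 then 0 else z m / fact m)) i
        = fps_nth (fps_X * G z) i"
      by (cases i) (simp_all add: G_def del: fact_Suc)
  qed
  have pow: "fps_nth (G x ^ j) i = fps_nth (G y ^ j) i" if "i \<le> n - k" for i j
    using that
  proof (induction j arbitrary: i)
    case (Suc j)
    have "fps_nth (G x) a = fps_nth (G y) a" if "a \<le> i" for a
      using assms[of "Suc a"] that Suc.prems by (simp add: G_def)
    then show ?case
      unfolding power_Suc fps_mult_nth using Suc
      by (intro sum.cong refl arg_cong2[where f = "(*)"]) auto
  qed simp
  show ?thesis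
    unfolding partial_Bell_def shift power_mult_distrib
    by (simp add: fps_X_power_mult_nth pow)
qed

text \<open>
  \<open>central_T M Y n k\<close> is \<open>T\<^sup>Y(n,k)\<close>: \<open>n!\<close> times the \<open>n\<close>-th Taylor coefficient at \<open>0\<close>
  of the generating function \<open>central_gf M Y k\<close>.
\<close>

definition central_gf :: "'a measure \<Rightarrow> ('a \<Rightarrow> real) \<Rightarrow> nat \<Rightarrow> real \<Rightarrow> real" where
  "central_gf M Y k t =
     1 / fact k * ((\<integral>\<omega>. exp (Y \<omega> / 2 * t) \<partial>M) - (\<integral>\<omega>. exp (- (Y \<omega> / 2) * t) \<partial>M)) ^ k"

definition central_T :: "'a measure \<Rightarrow> ('a \<Rightarrow> real) \<Rightarrow> nat \<Rightarrow> nat \<Rightarrow> real" where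
  "central_T M Y n k = fact n * fps_nth (THE F. central_gf M Y k has_fps_expansion F) n"

definition central_Bell :: "'a measure \<Rightarrow> ('a \<Rightarrow> real) \<Rightarrow> nat \<Rightarrow> real \<Rightarrow> real" where
  "central_Bell M Y n x = (\<Sum>k=0..n. central_T M Y n k * x ^ k)"

text \<open>
  The Taylor expansion in \<open>central_T\<close> exists and is unique whenever the moment generating
  function of \<open>Y\<close> exists near \<open>0\<close>, and its coefficients of index below \<open>k\<close> vanish.
\<close>

lemma has_fps_expansion_unique_real:
  fixes f :: "real \<Rightarrow> real"
  assumes "f has_fps_expansion F" "f has_fps_expansion G"
  shows "F = G"
proof (rule ccontr)
  assume "F \<noteq> G"
  define H where "H = F - G"
  have "H \<noteq> 0" using \<open>F \<noteq> G\<close> by (simp add: H_def)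
  have "(\<lambda>t. f t - f t) has_fps_expansion H"
    unfolding H_def by (intro has_fps_expansion_diff assms)
  then have H0: "(\<lambda>_. 0) has_fps_expansion H" by simp
  define c where "c = fps_nth H (subdegree H)"
  have "(\<lambda>t. if t = 0 then c else 0 / t ^ subdegree H) has_fps_expansion
      fps_shift (subdegree H) H"
    by (intro has_fps_expansion_shift H0) (auto simp: c_def)
  then have "isCont (\<lambda>t::real. if t = 0 then c else 0 / t ^ subdegree H) 0"
    by (rule has_fps_expansion_imp_continuous)
  then have "(\<lambda>t::real. if t = 0 then c else 0) \<midarrow>0\<rightarrow> c"
    by (simp add: isCont_def cong: if_cong)
  moreover have "(\<lambda>t::real. if t = 0 then c else 0) \<midarrow>0\<rightarrow> 0"
    by (rule tendsto_eventually) (auto simp: eventually_at_filter)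
  ultimately have "c = 0" by (rule LIM_unique)
  with \<open>H \<noteq> 0\<close> show False by (simp add: c_def)
qed

lemma mgf_has_fps_expansion:
  fixes Z :: "'a \<Rightarrow> real"
  assumes meas [measurable]: "Z \<in> borel_measurable M"
    and "r > 0"
    and int: "\<And>t. \<bar>t\<bar> < r \<Longrightarrow> integrable M (\<lambda>\<omega>. exp (t * Z \<omega>))"
  shows "(\<lambda>t. \<integral>\<omega>. exp (Z \<omega> * t) \<partial>M) has_fps_expansion
    Abs_fps (\<lambda>n. (\<integral>\<omega>. Z \<omega> ^ n \<partial>M) / fact n)" (is "?m has_fps_expansion ?F")
proof -
  have *: "(\<lambda>n. fps_nth ?F n * t ^ n) sums ?m t" if t: "\<bar>t\<bar> < r" for t
  proof -
    define f where "f n \<omega> = (Z \<omega> * t) ^ n / fact n" for n \<omega>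
    define g where "g \<omega> = exp \<bar>Z \<omega> * t\<bar>" for \<omega>
    have f_meas [measurable]: "f n \<in> borel_measurable M" for n
      unfolding f_def by measurable
    have g_meas [measurable]: "g \<in> borel_measurable M"
      unfolding g_def by measurable
    have norm_f: "(\<lambda>n. norm (f n \<omega>)) sums g \<omega>" for \<omega>
      using exp_converges[of "\<bar>Z \<omega> * t\<bar>"]
      by (simp add: f_def g_def power_abs abs_mult divide_inverse mult_ac)
    have g_int: "integrable M g"
    proof (rule Bochner_Integration.integrable_bound)
      show "integrable M (\<lambda>\<omega>. exp (t * Z \<omega>) + exp (- t * Z \<omega>))"
        using int[of t] int[of "- t"] t by auto
      show "AE \<omega> in M. norm (g \<omega>) \<le> norm (exp (t * Z \<omega>) + exp (- t * Z \<omega>))"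
        by (simp add: g_def mult_ac abs_of_pos[OF add_pos_pos]) (simp add: abs_if)
    qed measurable
    have partial: "(\<Sum>i<n. norm (f i \<omega>)) \<le> g \<omega>" for n \<omega>
      using norm_f[of \<omega>] sum_le_suminf[of "\<lambda>i. norm (f i \<omega>)" "{..<n}"]
      by (simp add: sums_iff)
    have f_int: "integrable M (f n)" for n
    proof (rule Bochner_Integration.integrable_bound[OF g_int])
      have "norm (f n \<omega>) \<le> norm (g \<omega>)" for \<omega>
      proof -
        have "norm (f n \<omega>) \<le> (\<Sum>i<Suc n. norm (f i \<omega>))" by (simp add: sum_nonneg)
        also have "\<dots> \<le> g \<omega>" by (rule partial)
        finally show ?thesis by (simp add: g_def)
      qed
      then show "AE \<omega> in M. norm (f n \<omega>) \<le> norm (g \<omega>)" by simp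
    qed measurable
    have "summable (\<lambda>i. \<integral>\<omega>. norm (f i \<omega>) \<partial>M)"
    proof (rule summableI_nonneg_bounded)
      show "(\<Sum>i<n. \<integral>\<omega>. norm (f i \<omega>) \<partial>M) \<le> integral\<^sup>L M g" for n
        using integral_mono[OF _ g_int, of "\<lambda>\<omega>. \<Sum>i<n. norm (f i \<omega>)"] partial f_int
        by (simp add: Bochner_Integration.integral_sum)
    qed (simp add: integral_nonneg_AE)
    then have "(\<lambda>n. integral\<^sup>L M (f n)) sums (\<integral>\<omega>. (\<Sum>n. f n \<omega>) \<partial>M)"
      using f_int norm_f by (intro sums_integral) (auto simp: sums_iff)
    moreover have "(\<Sum>n. f n \<omega>) = exp (Z \<omega> * t)" for \<omega>
      by (simp add: f_def exp_def divide_inverse mult_ac)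
    moreover have "integral\<^sup>L M (f n) = fps_nth ?F n * t ^ n" for n
      unfolding f_def by (simp add: power_mult_distrib)
    ultimately show ?thesis by simp
  qed
  have "conv_radius (fps_nth ?F) \<ge> norm (r / 2)"
    using *[of "r / 2"] \<open>r > 0\<close> by (intro conv_radius_geI) (auto simp: sums_iff)
  moreover have "ereal (norm (r / 2)) > 0" using \<open>r > 0\<close> by simp
  ultimately have "fps_conv_radius ?F > 0"
    unfolding fps_conv_radius_def by (rule less_le_trans[rotated])
  moreover have "\<forall>\<^sub>F t in nhds 0. eval_fps ?F t = ?m t"
    unfolding eventually_nhds_metric eval_fps_def
    using * \<open>r > 0\<close> by (intro exI[of _ r]) (auto simp: sums_iff)
  ultimately show ?thesis by (simp add: has_fps_expansion_def)
qed

lemma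
  fixes Y :: "'a \<Rightarrow> real"
  assumes "prob_space M" "Y \<in> borel_measurable M" "r > 0"
    and int: "\<And>t. \<bar>t\<bar> < r \<Longrightarrow> integrable M (\<lambda>\<omega>. exp (t * Y \<omega>))"
  shows central_gf_has_fps_expansion:
      "central_gf M Y k has_fps_expansion Abs_fps (\<lambda>n. central_T M Y n k / fact n)"
    and central_T_eq_0: "n < k \<Longrightarrow> central_T M Y n k = 0"
proof -
  interpret prob_space M by fact
  define F where "F c = Abs_fps (\<lambda>n. (\<integral>\<omega>. (c * Y \<omega>) ^ n \<partial>M) / fact n)" for c :: real
  have F: "(\<lambda>t. \<integral>\<omega>. exp ((c * Y \<omega>) * t) \<partial>M) has_fps_expansion F c" if "\<bar>c\<bar> \<le> 1" for c
    unfolding F_def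
  proof (rule mgf_has_fps_expansion)
    show "integrable M (\<lambda>\<omega>. exp (t * (c * Y \<omega>)))" if "\<bar>t\<bar> < r" for t
    proof -
      have "\<bar>t * c\<bar> \<le> \<bar>t\<bar>" using \<open>\<bar>c\<bar> \<le> 1\<close> by (simp add: abs_mult mult_left_le)
      with int[of "t * c"] that show ?thesis by (simp add: mult_ac)
    qed
  qed (use assms in auto)
  define D where "D = F (1 / 2) - F (- 1 / 2)"
  have D: "(\<lambda>t. (\<integral>\<omega>. exp (Y \<omega> / 2 * t) \<partial>M) - (\<integral>\<omega>. exp (- (Y \<omega> / 2) * t) \<partial>M))
      has_fps_expansion D"
    using has_fps_expansion_diff[OF F[of "1 / 2"] F[of "- 1 / 2"]] by (simp add: D_def)
  have "(\<lambda>t. ((\<integral>\<omega>. exp (Y \<omega> / 2 * t) \<partial>M) - (\<integral>\<omega>. exp (- (Y \<omega> / 2) * t) \<partial>M)) ^ k)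
      has_fps_expansion D ^ k" for k
    by (induction k) (simp_all only: power_0 power_Suc has_fps_expansion_1 has_fps_expansion_mult D)
  then have gf: "central_gf M Y k has_fps_expansion fps_const (1 / fact k) * D ^ k" for k
    unfolding central_gf_def [abs_def]
    by (rule has_fps_expansion_cmult_left)
  have "(THE F. central_gf M Y k has_fps_expansion F) = fps_const (1 / fact k) * D ^ k" for k
    by (rule the_equality) (use gf has_fps_expansion_unique_real in blast)+
  then have T: "central_T M Y n k = fact n * fps_nth (fps_const (1 / fact k) * D ^ k) n" for n k
    by (simp add: central_T_def)
  show "central_gf M Y k has_fps_expansion Abs_fps (\<lambda>n. central_T M Y n k / fact n)"
  proof -
    have "Abs_fps (\<lambda>n. central_T M Y n k / fact n) = fps_const (1 / fact k) * D ^ k"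
      by (rule fps_ext) (simp add: T)
    with gf[of k] show ?thesis by simp
  qed
  have "fps_nth D 0 = 0"
    by (simp add: D_def F_def)
  then show "central_T M Y n k = 0" if "n < k"
    using that startsby_zero_power_prefix[of D k] by (simp add: T)
qed

end

theory Submission
  imports Defs
begin

text \<open>
  With \<open>D(t) = E[e\<^bsup>tY/2\<^esup>] - E[e\<^bsup>-tY/2\<^esup>]\<close>, the exponential generating function of
  \<open>central_Bell M Y m x\<close> is \<open>e\<^bsup>x D(t)\<^esup>\<close>. Hence the partial Bell polynomial is a coefficient of
  \<open>(e\<^bsup>x D\<^esup> - 1)\<^bsup>k\<^esup> / k!\<close>, which is the Stirling series \<open>\<Sum>j. Stirling j k * (x u)\<^bsup>j\<^esup> / j!\<close>
  composed with \<open>u = D\<close>; and \<open>D\<^bsup>j\<^esup> / j!\<close> generates \<open>central_T M Y n j\<close>.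
\<close>

text \<open>Since \<open>E = fps_exp c - 1\<close> satisfies \<open>E' = c (E + 1)\<close>, the
  derivative of \<open>E ^ k\<close> is \<open>k c (E ^ k + E ^ (k - 1))\<close>; comparing
  coefficients gives the recurrence of \<open>Stirling\<close>.\<close>

lemma fps_nth_fps_exp_minus_one_power:
  fixes c :: "'a::field_char_0"
  shows "fps_nth ((fps_exp c - 1) ^ k) n = fact k * of_nat (Stirling n k) * c ^ n / fact n"
proof (induction n arbitrary: k)
  case 0
  then show ?case by (cases k) auto
next
  case (Suc n)
  show ?case
  proof (cases k)
    case 0
    then show ?thesis by simp
  next
    case (Suc l)
    define E where "E = fps_exp c - 1"
    have dE: "fps_deriv E = fps_const c * (E + 1)"
      by (simp add: E_def)
    have "fps_const (of_nat k * c) = of_nat k * fps_const c"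
      by (simp add: fps_of_nat flip: fps_const_mult)
    then have "fps_deriv (E ^ k) = fps_const (of_nat k * c) * (E ^ k + E ^ l)"
      unfolding fps_deriv_power dE by (simp add: Suc fps_of_nat algebra_simps)
    then have "of_nat (Suc n) * fps_nth (E ^ k) (Suc n)
        = of_nat k * c * (fps_nth (E ^ k) n + fps_nth (E ^ l) n)"
      by (metis Suc_eq_plus1 fps_add_nth fps_deriv_nth fps_mult_left_const_nth)
    also have "\<dots> = fact k * of_nat (Stirling (Suc n) k) * c ^ Suc n / fact n"
      unfolding E_def Suc.IH by (simp add: Suc field_simps)
    finally show ?thesis
      unfolding E_def by (simp add: field_simps del: of_nat_Suc)
  qed
qed

lemma partial_Bell_exp_compose:
  assumes D0: "fps_nth D 0 = 0"
    and b: "\<And>m. b m = fact m * (\<Sum>j=0..m. fps_nth (D ^ j) m * x ^ j / fact j)"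
  shows "partial_Bell n k b =
    fact n * (\<Sum>j=0..n. real (Stirling j k) * x ^ j * (fps_nth (D ^ j) n / fact j))"
proof -
  have egf: "Abs_fps (\<lambda>m. if m = 0 then 0 else b m / fact m) = (fps_exp x - 1) oo D"
  proof (rule fps_ext)
    fix m
    have "fps_nth ((fps_exp x - 1) oo D) m = fps_nth (fps_exp x oo D) m - fps_nth 1 m"
      by (simp add: fps_compose_sub_distrib)
    also have "\<dots> = b m / fact m - fps_nth 1 m"
      by (simp add: fps_compose_nth b mult_ac)
    \<comment> \<open>Here \<open>b 0 = 1\<close>, so subtracting \<open>1\<close> removes exactly
      the constant term.\<close>
    finally show "fps_nth (Abs_fps (\<lambda>m. if m = 0 then 0 else b m / fact m)) m
        = fps_nth ((fps_exp x - 1) oo D) m"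
      by (simp add: b)
  qed
  show ?thesis
    \<comment> \<open>By \<open>D0\<close>, the \<open>k\<close>-th power moves inside the
      composition; the factor \<open>fact k\<close> then cancels.\<close>
    unfolding partial_Bell_def egf fps_compose_power [OF D0]
    by (simp add: fps_compose_nth fps_nth_fps_exp_minus_one_power sum_distrib_left mult_ac)
qed

theorem theorem2p12:
  fixes M :: "'a measure" and Y :: "'a \<Rightarrow> real" and r x :: real and n k :: nat
  assumes "prob_space M"
    and "Y \<in> borel_measurable M"
    and "r > 0"
    and "\<And>t. \<bar>t\<bar> < r \<Longrightarrow> integrable M (\<lambda>\<omega>. exp (t * Y \<omega>))"
    and "k \<le> n"
  shows "partial_Bell n k (\<lambda>m. central_Bell M Y m x) =
    (\<Sum>j=k..n. real (Stirling j k) * central_T M Y n j * x ^ j)"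
proof -
  \<comment> \<open>Column \<open>1\<close> of \<open>central_T\<close> encodes the difference of
    the two expectations, as \<open>fact 1 = 1\<close>.\<close>
  define D where "D = Abs_fps (\<lambda>m. central_T M Y m 1 / fact m)"
  have gf: "central_gf M Y j has_fps_expansion Abs_fps (\<lambda>m. central_T M Y m j / fact m)" for j
    using assms(1-4) by (rule central_gf_has_fps_expansion)
  have D: "central_gf M Y 1 has_fps_expansion D"
    unfolding D_def by (rule gf)
  have D_power: "(\<lambda>t. central_gf M Y 1 t ^ j) has_fps_expansion D ^ j" for j
    by (induction j) (simp_all only: power_0 power_Suc has_fps_expansion_1 has_fps_expansion_mult D)
  have "central_gf M Y j has_fps_expansion fps_const (1 / fact j) * D ^ j" for j
    using has_fps_expansion_cmult_left[OF D_power[of j], of "1 / fact j"]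
    by (simp add: central_gf_def [abs_def])
  \<comment> \<open>Both series expand \<open>central_gf M Y j\<close>, so uniqueness expresses
    column \<open>j\<close> through \<open>D ^ j\<close>.\<close>
  then have "Abs_fps (\<lambda>m. central_T M Y m j / fact m) = fps_const (1 / fact j) * D ^ j" for j
    by (rule has_fps_expansion_unique_real[OF gf])
  then have "central_T M Y m j / fact m = fps_nth (D ^ j) m / fact j" for m j
    by (metis (no_types, lifting) fps_mult_left_const_nth fps_nth_Abs_fps mult_1 times_divide_eq_left)
  then have T: "central_T M Y m j = fact m * (fps_nth (D ^ j) m / fact j)" for m j
    by (simp add: field_simps)
  have "central_T M Y 0 1 = 0"
    using assms(1-4) by (rule central_T_eq_0) simp_all
  then have "fps_nth D 0 = 0"
    by (simp add: D_def)
  then have "partial_Bell n k (\<lambda>m. central_Bell M Y m x) =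
      fact n * (\<Sum>j=0..n. real (Stirling j k) * x ^ j * (fps_nth (D ^ j) n / fact j))"
    by (rule partial_Bell_exp_compose)
      (simp add: central_Bell_def T sum_distrib_left mult_ac)
  also have "\<dots> = (\<Sum>j=0..n. real (Stirling j k) * central_T M Y n j * x ^ j)"
    by (simp add: T sum_distrib_left mult_ac)
  \<comment> \<open>\<open>Stirling j k\<close> vanishes for \<open>j < k\<close>.\<close>
  also have "\<dots> = (\<Sum>j=k..n. real (Stirling j k) * central_T M Y n j * x ^ j)"
    by (rule sum.mono_neutral_right) auto
  finally show ?thesis .
qed

end
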